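(* Let $(p^\star,x^\star)$ be an optimal solution of the social welfare maximization problem described in the context and let $\lambda^\star_{n,s}$, $\underline\eta^\star_{i,s}$, $\overline\eta^\star_{i,s}$ be optimal dual variables. Let $n\in[N]$ and $s\in[S]$. (a) If there exists a participant $i\in\mathcal I^{\mathrm{RT}}_n$ whose utility function is differentiable and whose optimal contingent power injection lies in the interior of the local feasible set, i.e. $p^\star_{i,s}\in\operatorname{int}\mathcal P_{i,s}$, then $$\lambda^\star_{n,s}=-\mathbb P(s)\,\frac{\partial\tilde u_{i,s}(p^\star_{i,s})}{\partial p_{i,s}} .$$ (b) In general, if the utility function of some participant $i\in\mathcal I^{\mathrm{RT}}_n$ is differentiable, then $$\lambda^\star_{n,s}=-\mathbb P(s)\,\frac{\partial\tilde u_{i,s}(p^\star_{i,s})}{\partial p_{i,s}}+\big(\overline\eta^\star_{i,s}-\underline\eta^\star_{i,s}\big).$$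
   Context: **Network.** There are $N$ buses and $L$ lines. With $\widehat H\in\mathbb R^{L\times N}$ and capacities $\bar r\in\mathbb R^L$, the set of feasible nodal injections is $\mathcal P=\{p\in\mathbb R^N:-\bar r\le\widehat Hp\le\bar r,\ \mathbf 1^\top p=0\}$, assumed to have nonempty interior relative to $\{p:\mathbf 1^\top p=0\}$. **Uncertainty.** There are finitely many scenarios $s\in[S]=\{1,\dots,S\}$ with probabilities $\mathbb P(s)>0$ summing to $1$. **Participants.** $\mathcal I=\bigcup_{n\in[N]}\mathcal I_n$ is a finite set, $\mathcal I_n$ (pairwise disjoint) being the participants at bus $n$. Each $\mathcal I_n$ is partitioned into day-ahead participants $\mathcal I_n^{\mathrm{DA}}$ and real-time participants $\mathcal I_n^{\mathrm{RT}}$; $\mathcal I^{\mathrm{DA}}=\bigcup_n\mathcal I_n^{\mathrm{DA}}$ and $\mathcal I^{\mathrm{RT}}=\bigcup_n\mathcal I_n^{\mathrm{RT}}$. Participant $i$ has plan $p_i=(p_{i,s})_s\in\mathbb R^S$. For each $s$, $\mathcal P_{i,s}=[\underline p_{i,s},\overline p_{i,s}]$ is a compact interval of the form $[0,\bar p_{i,s}]$ (producer) or $[-\bar p_{i,s},0]$ (load). Let $\bar{\mathcal P}_i=\{p_i:p_{i,s}\in\mathcal P_{i,s}\ \forall s\}$; $\mathcal P_i=\bar{\mathcal P}_i$ for $i\in\mathcal I^{\mathrm{RT}}$, and $\mathcal P_i=\bar{\mathcal P}_i\cap\{p_i:p_{i,s}=p_{i,\tilde s}\ \forall s,\tilde s\}$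 for $i\in\mathcal I^{\mathrm{DA}}$. The utility from injection in scenario $s$ is a concave function $\tilde u_{i,s}:\mathbb R\to\mathbb R$; "the utility function of $i$ is differentiable" means each $\tilde u_{i,s}$ is differentiable. **Social welfare maximization problem** (under budget balance, equivalently stochastic economic dispatch). Maximize $U(p)=\sum_{i\in\mathcal I}\sum_{s\in[S]}\mathbb P(s)\tilde u_{i,s}(p_{i,s})$ over $(p,x)$ subject to $p_i\in\mathcal P_i$ ($i\in\mathcal I$), $x_{n,s}=\sum_{i\in\mathcal I_n}p_{i,s}$ ($n\in[N],s\in[S]$), and $x_s=(x_{n,s})_n\in\mathcal P$ ($s\in[S]$). **Dual variables.** $\lambda_{n,s}\in\mathbb R$ is the multiplier of the constraint $x_{n,s}=\sum_{i\in\mathcal I_n}p_{i,s}$. For $i\in\mathcal I^{\mathrm{RT}}$, $\underline\eta_{i,s},\overline\eta_{i,s}\ge0$ are the multipliers of $\underline p_{i,s}\le p_{i,s}$ and $p_{i,s}\le\overline p_{i,s}$. The Lagrangian is $$U(p)+\sum_{n,s}\lambda_{n,s}\Big(\sum_{i\in\mathcal I_n}p_{i,s}-x_{n,s}\Big)-\sum_{i\in\mathcal I^{\mathrm{RT}},s}\overline\eta_{i,s}(p_{i,s}-\overline p_{i,s})-\sum_{i\in\mathcal I^{\mathrm{RT}},s}\underline\eta_{i,s}(\underline p_{i,s}-p_{i,s}).$$ Optimal dual variables are multipliers (with $\underline\eta^\star,\overline\eta^\star\ge0$) such that $(p^\star,x^\star)$ maximizes the Lagrangian over $p_i\in\mathbb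 R^S$ ($i\in\mathcal I^{\mathrm{RT}}$), $p_i\in\mathcal P_i$ ($i\in\mathcal I^{\mathrm{DA}}$), $x_s\in\mathcal P$ ($s\in[S]$), and complementary slackness holds: $\overline\eta^\star_{i,s}(p^\star_{i,s}-\overline p_{i,s})=0$ and $\underline\eta^\star_{i,s}(\underline p_{i,s}-p^\star_{i,s})=0$. The sign convention is that $p_{i,s}>0$ is power supplied to the network. *)

theory Defs
  imports "HOL-Analysis.Analysis"
begin

text \<open>
  Buses, lines and scenarios are indexed by finite types; participants form a finite set of
  elements of an arbitrary type. A plan \<open>p\<close> gives each participant \<open>i\<close> a vector over the scenarios,
  and \<open>x s\<close> is the vector of nodal injections in scenario \<open>s\<close>. Values attached to elements
  that are not participants are irrelevant throughout.
\<close>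

record ('n, 'l, 's, 'i) market =
  flow_matrix :: "real ^ 'n::finite ^ 'l::finite"
  line_cap :: "real ^ 'l"
  prb :: "'s::finite \<Rightarrow> real"
  da_at :: "'n \<Rightarrow> 'i set"
  rt_at :: "'n \<Rightarrow> 'i set"
  p_lo :: "'i \<Rightarrow> 's \<Rightarrow> real"
  p_hi :: "'i \<Rightarrow> 's \<Rightarrow> real"
  util :: "'i \<Rightarrow> 's \<Rightarrow> real \<Rightarrow> real"

definition parts_at :: "('n::finite, 'l::finite, 's::finite, 'i) market \<Rightarrow> 'n \<Rightarrow> 'i set" where
  "parts_at M n = da_at M n \<union> rt_at M n"

definition da_parts :: "('n::finite, 'l::finite, 's::finite, 'i) market \<Rightarrow> 'i set" where
  "da_parts M = (\<Union>n. da_at M n)"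

definition rt_parts :: "('n::finite, 'l::finite, 's::finite, 'i) market \<Rightarrow> 'i set" where
  "rt_parts M = (\<Union>n. rt_at M n)"

definition parts :: "('n::finite, 'l::finite, 's::finite, 'i) market \<Rightarrow> 'i set" where
  "parts M = (\<Union>n. parts_at M n)"

definition balanced :: "(real ^ 'n::finite) set" where
  "balanced = {q. (\<Sum>n\<in>UNIV. q $ n) = 0}"

text \<open>The order on vectors is the componentwise one.\<close>

definition injections :: "('n::finite, 'l::finite, 's::finite, 'i) market \<Rightarrow> (real ^ 'n) set" where
  "injections M =
     {q. - line_cap M \<le> flow_matrix M *v q \<and> flow_matrix M *v q \<le> line_cap M \<and> q \<in> balanced}"

definition local_set ::
  "('n::finite, 'l::finite, 's::finite, 'i) market \<Rightarrow> 'i \<Rightarrow> 's \<Rightarrow> real set" where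
  "local_set M i s = {p_lo M i s .. p_hi M i s}"

definition plan_box ::
  "('n::finite, 'l::finite, 's::finite, 'i) market \<Rightarrow> 'i \<Rightarrow> (real ^ 's) set" where
  "plan_box M i = {v. \<forall>s. v $ s \<in> local_set M i s}"

definition plan_set ::
  "('n::finite, 'l::finite, 's::finite, 'i) market \<Rightarrow> 'i \<Rightarrow> (real ^ 's) set" where
  "plan_set M i =
     (if i \<in> da_parts M then plan_box M i \<inter> {v. \<forall>s t. v $ s = v $ t} else plan_box M i)"

definition valid_market :: "('n::finite, 'l::finite, 's::finite, 'i) market \<Rightarrow> bool" where
  "valid_market M \<longleftrightarrow>
     (top_of_set balanced) interior_of (injections M) \<noteq> {} \<and>
     (\<forall>s. 0 < prb M s) \<and> (\<Sum>s\<in>UNIV. prb M s) = 1 \<and>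
     finite (parts M) \<and> disjoint_family (parts_at M) \<and> (\<forall>n. da_at M n \<inter> rt_at M n = {}) \<and>
     (\<forall>i\<in>parts M. \<forall>s. (p_lo M i s = 0 \<and> 0 \<le> p_hi M i s) \<or> (p_lo M i s \<le> 0 \<and> p_hi M i s = 0)) \<and>
     (\<forall>i\<in>parts M. \<forall>s. concave_on UNIV (util M i s))"

definition welfare ::
  "('n::finite, 'l::finite, 's::finite, 'i) market \<Rightarrow> ('i \<Rightarrow> real ^ 's) \<Rightarrow> real" where
  "welfare M p = (\<Sum>i\<in>parts M. \<Sum>s\<in>UNIV. prb M s * util M i s (p i $ s))"

definition feasible ::
  "('n::finite, 'l::finite, 's::finite, 'i) market \<Rightarrow> ('i \<Rightarrow> real ^ 's) \<Rightarrow> ('s \<Rightarrow> real ^ 'n) \<Rightarrow> bool"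
where
  "feasible M p x \<longleftrightarrow>
     (\<forall>i\<in>parts M. p i \<in> plan_set M i) \<and>
     (\<forall>n s. x s $ n = (\<Sum>i\<in>parts_at M n. p i $ s)) \<and>
     (\<forall>s. x s \<in> injections M)"

definition optimal_solution ::
  "('n::finite, 'l::finite, 's::finite, 'i) market \<Rightarrow> ('i \<Rightarrow> real ^ 's) \<Rightarrow> ('s \<Rightarrow> real ^ 'n) \<Rightarrow> bool"
where
  "optimal_solution M p x \<longleftrightarrow>
     feasible M p x \<and> (\<forall>p' x'. feasible M p' x' \<longrightarrow> welfare M p' \<le> welfare M p)"

definition lagrangian ::
  "('n::finite, 'l::finite, 's::finite, 'i) market \<Rightarrow>
   ('n \<Rightarrow> 's \<Rightarrow> real) \<Rightarrow> ('i \<Rightarrow> 's \<Rightarrow> real) \<Rightarrow> ('i \<Rightarrow> 's \<Rightarrow> real) \<Rightarrow>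
   ('i \<Rightarrow> real ^ 's) \<Rightarrow> ('s \<Rightarrow> real ^ 'n) \<Rightarrow> real"
where
  "lagrangian M lam eta_lo eta_hi p x =
     welfare M p
     + (\<Sum>n\<in>UNIV. \<Sum>s\<in>UNIV. lam n s * ((\<Sum>i\<in>parts_at M n. p i $ s) - x s $ n))
     - (\<Sum>i\<in>rt_parts M. \<Sum>s\<in>UNIV. eta_hi i s * (p i $ s - p_hi M i s))
     - (\<Sum>i\<in>rt_parts M. \<Sum>s\<in>UNIV. eta_lo i s * (p_lo M i s - p i $ s))"

text \<open>
  The bounds of real-time participants are dualised, so their plans are unconstrained here,
  whereas the constraints of day-ahead participants and of the network are kept.
\<close>

definition lagrangian_domain ::
  "('n::finite, 'l::finite, 's::finite, 'i) market \<Rightarrow> (('i \<Rightarrow> real ^ 's) \<times> ('s \<Rightarrow> real ^ 'n)) set"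
where
  "lagrangian_domain M =
     {(p, x). (\<forall>i\<in>da_parts M. p i \<in> plan_set M i) \<and> (\<forall>s. x s \<in> injections M)}"

definition optimal_dual ::
  "('n::finite, 'l::finite, 's::finite, 'i) market \<Rightarrow> ('i \<Rightarrow> real ^ 's) \<Rightarrow> ('s \<Rightarrow> real ^ 'n) \<Rightarrow>
   ('n \<Rightarrow> 's \<Rightarrow> real) \<Rightarrow> ('i \<Rightarrow> 's \<Rightarrow> real) \<Rightarrow> ('i \<Rightarrow> 's \<Rightarrow> real) \<Rightarrow> bool"
where
  "optimal_dual M p x lam eta_lo eta_hi \<longleftrightarrow>
     (\<forall>i\<in>rt_parts M. \<forall>s. 0 \<le> eta_lo i s \<and> 0 \<le> eta_hi i s) \<and>
     (p, x) \<in> lagrangian_domain M \<and>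
     (\<forall>(p', x')\<in>lagrangian_domain M.
        lagrangian M lam eta_lo eta_hi p' x' \<le> lagrangian M lam eta_lo eta_hi p x) \<and>
     (\<forall>i\<in>rt_parts M. \<forall>s. eta_hi i s * (p i $ s - p_hi M i s) = 0 \<and>
                         eta_lo i s * (p_lo M i s - p i $ s) = 0)"

definition differentiable_utility ::
  "('n::finite, 'l::finite, 's::finite, 'i) market \<Rightarrow> 'i \<Rightarrow> bool" where
  "differentiable_utility M i \<longleftrightarrow> (\<forall>s. util M i s differentiable_on UNIV)"

end

theory Submission
  imports Defs
begin

text \<open>
  The Lagrangian leaves the plan of a real-time participant unconstrained, so as a function of the
  single coordinate \<open>p i $ s\<close> it attains its maximum over the whole line at the optimum, and its
  derivative vanishes there; this is (b). In the interior, complementary slackness forces both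
  bound multipliers to be zero, which gives (a).
\<close>

text \<open>Taking differences makes every unchanged summand cancel; iterating this traces a change
  of one coordinate through the nested sums of the Lagrangian.\<close>

lemma sum_diff_single:
  fixes f g :: "'a \<Rightarrow> 'b::ab_group_add"
  assumes "finite A" "a \<in> A" "\<And>b. b \<in> A \<Longrightarrow> b \<noteq> a \<Longrightarrow> f b = g b"
  shows "sum f A - sum g A = f a - g a"
proof -
  have "sum f (A - {a}) = sum g (A - {a})"
    using assms(3) by (intro sum.cong) auto
  then show ?thesis
    using assms(1,2) by (simp add: sum.remove)
qed

context
  fixes M :: "('n::finite, 'l::finite, 's::finite, 'i) market" and n :: 'n and i :: 'i
  assumes valid: "valid_market M" and rt: "i \<in> rt_at M n"
begin

text \<open>By disjointness of the buses, a change in the plan of \<open>i\<close> affects the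
  balance of bus \<open>n\<close> and of no other bus.\<close>

lemma participant_at_iff: "i \<in> parts_at M m \<longleftrightarrow> m = n"
proof -
  have "i \<in> parts_at M n"
    using rt by (simp add: parts_at_def)
  then show ?thesis
    using valid unfolding valid_market_def disjoint_family_on_def by blast
qed

text \<open>Validity separates day-ahead from real-time participants only bus by bus, so both
  memberships must first be placed at the same bus \<open>n\<close>.\<close>

lemma rt_participant_not_da: "i \<notin> da_parts M"
proof
  assume "i \<in> da_parts M"
  then obtain m where m: "i \<in> da_at M m"
    by (auto simp: da_parts_def)
  then have "m = n"
    using participant_at_iff[of m] by (simp add: parts_at_def)
  then show False
    using m rt valid by (auto simp: valid_market_def)
qed

text \<open>Welfare and the two bound terms are separable over participants and scenarios, and the
  balance term is linear in the plans. Terms in \<open>x\<close> and in the bounds are constant in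
  \<open>t\<close> and cancel, leaving the increment of a function of one real variable.\<close>

lemma lagrangian_single_change:
  fixes p :: "'i \<Rightarrow> real ^ 's" and s :: 's and t :: real
  defines "q \<equiv> p(i := (\<chi> r. if r = s then t else p i $ r))"
  shows "lagrangian M lam eta_lo eta_hi q x - lagrangian M lam eta_lo eta_hi p x =
    (prb M s * util M i s t + (lam n s - eta_hi i s + eta_lo i s) * t) -
    (prb M s * util M i s (p i $ s) + (lam n s - eta_hi i s + eta_lo i s) * (p i $ s))"
proof -
  have fin: "finite (parts M)"
    using valid by (simp add: valid_market_def)
  have fin_rt: "finite (rt_parts M)"
    by (rule finite_subset[OF _ fin]) (auto simp: parts_def parts_at_def rt_parts_def)
  have fin_at: "finite (parts_at M n)"
    by (rule finite_subset[OF _ fin]) (auto simp: parts_def)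
  have i_rt: "i \<in> rt_parts M" and i_parts: "i \<in> parts M"
    using rt by (auto simp: rt_parts_def parts_def parts_at_def)
  have q_other: "j \<noteq> i \<Longrightarrow> q j = p j" and q_i: "r \<noteq> s \<Longrightarrow> q i $ r = p i $ r"
    and q_s: "q i $ s = t" for j r
    by (simp_all add: q_def)
  \<comment> \<open>A general \<open>F\<close> covers three terms at once: welfare over
    \<open>parts M\<close> and each bound term over \<open>rt_parts M\<close>.\<close>
  have separable: "(\<Sum>j\<in>A. \<Sum>r\<in>UNIV. F j r (q j $ r)) - (\<Sum>j\<in>A. \<Sum>r\<in>UNIV. F j r (p j $ r)) =
      F i s t - F i s (p i $ s)"
    if "finite A" "i \<in> A" for A and F :: "'i \<Rightarrow> 's \<Rightarrow> real \<Rightarrow> real"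
  proof -
    have "(\<Sum>j\<in>A. \<Sum>r\<in>UNIV. F j r (q j $ r)) - (\<Sum>j\<in>A. \<Sum>r\<in>UNIV. F j r (p j $ r)) =
        (\<Sum>r\<in>UNIV. F i r (q i $ r)) - (\<Sum>r\<in>UNIV. F i r (p i $ r))"
      using that by (intro sum_diff_single) (auto simp: q_other)
    also have "\<dots> = F i s (q i $ s) - F i s (p i $ s)"
      by (intro sum_diff_single) (auto simp: q_i)
    finally show ?thesis
      by (simp add: q_s)
  qed
  have at_other: "(\<Sum>j\<in>parts_at M m. q j $ r) = (\<Sum>j\<in>parts_at M m. p j $ r)" if "m \<noteq> n" for m r
    by (rule sum.cong) (use that participant_at_iff[of m] in \<open>auto simp: q_def\<close>)
  have at_n: "(\<Sum>j\<in>parts_at M n. q j $ r) - (\<Sum>j\<in>parts_at M n. p j $ r) = q i $ r - p i $ r" for r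
    using fin_at participant_at_iff[of n] by (intro sum_diff_single) (auto simp: q_other)
  \<comment> \<open>The balance term has the participant sum inside a product, so
    \<open>separable\<close> does not apply; the difference is localised first to bus
    \<open>n\<close>, then to scenario \<open>s\<close>.\<close>
  have "(\<Sum>m\<in>UNIV. \<Sum>r\<in>UNIV. lam m r * ((\<Sum>j\<in>parts_at M m. q j $ r) - x r $ m)) -
      (\<Sum>m\<in>UNIV. \<Sum>r\<in>UNIV. lam m r * ((\<Sum>j\<in>parts_at M m. p j $ r) - x r $ m)) =
      (\<Sum>r\<in>UNIV. lam n r * ((\<Sum>j\<in>parts_at M n. q j $ r) - x r $ n)) -
      (\<Sum>r\<in>UNIV. lam n r * ((\<Sum>j\<in>parts_at M n. p j $ r) - x r $ n))"
    by (intro sum_diff_single) (auto simp: at_other)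
  also have "\<dots> = lam n s * ((\<Sum>j\<in>parts_at M n. q j $ s) - x s $ n) -
      lam n s * ((\<Sum>j\<in>parts_at M n. p j $ s) - x s $ n)"
  proof (intro sum_diff_single)
    fix r assume "r \<noteq> s"
    then have "(\<Sum>j\<in>parts_at M n. q j $ r) = (\<Sum>j\<in>parts_at M n. p j $ r)"
      using at_n[of r] q_i[of r] by simp
    then show "lam n r * ((\<Sum>j\<in>parts_at M n. q j $ r) - x r $ n) =
        lam n r * ((\<Sum>j\<in>parts_at M n. p j $ r) - x r $ n)"
      by simp
  qed auto
  also have "\<dots> = lam n s * ((\<Sum>j\<in>parts_at M n. q j $ s) - (\<Sum>j\<in>parts_at M n. p j $ s))"
    by (simp add: algebra_simps)
  also have "\<dots> = lam n s * (t - p i $ s)"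
    by (simp only: at_n q_s)
  finally have coupling: "(\<Sum>m\<in>UNIV. \<Sum>r\<in>UNIV. lam m r * ((\<Sum>j\<in>parts_at M m. q j $ r) - x r $ m)) -
      (\<Sum>m\<in>UNIV. \<Sum>r\<in>UNIV. lam m r * ((\<Sum>j\<in>parts_at M m. p j $ r) - x r $ m)) =
      lam n s * (t - p i $ s)" .
  show ?thesis
    unfolding lagrangian_def welfare_def
    using coupling separable[OF fin i_parts, of "\<lambda>j r v. prb M r * util M j r v"]
      separable[OF fin_rt i_rt, of "\<lambda>j r v. eta_hi j r * (v - p_hi M j r)"]
      separable[OF fin_rt i_rt, of "\<lambda>j r v. eta_lo j r * (p_lo M j r - v)"]
    by (simp add: algebra_simps)
qed

lemma optimal_dual_stationary:
  assumes dual: "optimal_dual M p x lam eta_lo eta_hi" and diff: "differentiable_utility M i"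
  shows "lam n s = - prb M s * deriv (util M i s) (p i $ s) + (eta_hi i s - eta_lo i s)"
proof -
  define c where "c = lam n s - eta_hi i s + eta_lo i s"
  \<comment> \<open>Up to an additive constant, \<open>g\<close> is the Lagrangian restricted to the
    coordinate \<open>p i $ s\<close>; \<open>c\<close> collects the multipliers acting on
    it.\<close>
  define g where "g t = prb M s * util M i s t + c * t" for t
  have max: "g t \<le> g (p i $ s)" for t
  proof -
    let ?q = "p(i := (\<chi> r. if r = s then t else p i $ r))"
    have "(p, x) \<in> lagrangian_domain M"
      using dual by (simp add: optimal_dual_def)
    \<comment> \<open>The domain restricts only day-ahead plans and \<open>x\<close>, and the
      perturbation touches neither.\<close>
    then have "(?q, x) \<in> lagrangian_domain M"
      using rt_participant_not_da by (auto simp: lagrangian_domain_def)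
    then have "lagrangian M lam eta_lo eta_hi ?q x \<le> lagrangian M lam eta_lo eta_hi p x"
      using dual by (auto simp: optimal_dual_def)
    then show ?thesis
      using lagrangian_single_change[of lam eta_lo eta_hi p s t x] by (simp add: g_def c_def)
  qed
  have "(util M i s has_real_derivative deriv (util M i s) (p i $ s)) (at (p i $ s))"
    using diff by (simp add: differentiable_utility_def differentiable_on_def
        DERIV_deriv_iff_real_differentiable)
  then have "(g has_real_derivative prb M s * deriv (util M i s) (p i $ s) + c) (at (p i $ s))"
    unfolding g_def by (auto intro!: derivative_eq_intros)
  \<comment> \<open>The maximum is global, so any positive radius serves for
    \<open>d\<close>.\<close>
  then have "prb M s * deriv (util M i s) (p i $ s) + c = 0"
    by (rule DERIV_local_max[where d = 1]) (auto simp: max)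
  then show ?thesis
    by (simp add: c_def)
qed

end

theorem lemma1:
  fixes M :: "('n::finite, 'l::finite, 's::finite, 'i) market"
    and p :: "'i \<Rightarrow> real ^ 's" and x :: "'s \<Rightarrow> real ^ 'n"
    and lam :: "'n \<Rightarrow> 's \<Rightarrow> real" and eta_lo eta_hi :: "'i \<Rightarrow> 's \<Rightarrow> real"
    and n :: 'n and s :: 's
  assumes "valid_market M"
    and "optimal_solution M p x"
    and "optimal_dual M p x lam eta_lo eta_hi"
  shows "(\<forall>i\<in>rt_at M n. differentiable_utility M i \<and> p i $ s \<in> interior (local_set M i s) \<longrightarrow>
            lam n s = - prb M s * deriv (util M i s) (p i $ s)) \<and>
         (\<forall>i\<in>rt_at M n. differentiable_utility M i \<longrightarrow>
            lam n s = - prb M s * deriv (util M i s) (p i $ s) + (eta_hi i s - eta_lo i s))"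
proof (intro conjI ballI impI)
  fix i assume i: "i \<in> rt_at M n" and diff: "differentiable_utility M i"
  show "lam n s = - prb M s * deriv (util M i s) (p i $ s) + (eta_hi i s - eta_lo i s)"
    by (rule optimal_dual_stationary[OF assms(1) i assms(3) diff])
next
  fix i assume i: "i \<in> rt_at M n"
    and "differentiable_utility M i \<and> p i $ s \<in> interior (local_set M i s)"
  then have diff: "differentiable_utility M i" and "p_lo M i s < p i $ s" "p i $ s < p_hi M i s"
    by (auto simp: local_set_def)
  moreover have "i \<in> rt_parts M"
    using i by (auto simp: rt_parts_def)
  \<comment> \<open>Both slacks are nonzero, so each complementary slackness product can vanish only
    through its multiplier.\<close>
  ultimately have "eta_hi i s = 0" "eta_lo i s = 0"
    using assms(3) by (fastforce simp: optimal_dual_def)+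
  then show "lam n s = - prb M s * deriv (util M i s) (p i $ s)"
    using optimal_dual_stationary[OF assms(1) i assms(3) diff, of s] by simp
qed

end
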